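(* Suppose that $\mu$ and $\kappa$ are infinite cardinals such that $\kappa$ is regular and is not the successor of a singular cardinal of cofinality $\mathrm{cf}(\mu)$. If $\mathcal G=(\kappa,E)$ is a graph and $\mathrm{Col}(\mathcal G_\alpha)\le\mu$ for every $\alpha<\kappa$, then $\mathrm{Col}(\mathcal G)\le\mu^+$.
   Context: A graph is a pair $\mathcal G=(V,E)$ with $E\subseteq[V]^2$. The coloring number $\mathrm{Col}(\mathcal G)$ is the least cardinal $\nu$ for which there exists a well-ordering $\lhd$ of $V$ such that $|\{y\in V\mid\{x,y\}\in E,\ y\lhd x\}|<\nu$ for all $x\in V$. For a graph $\mathcal G=(\kappa,E)$ and $\alpha<\kappa$, $\mathcal G_\alpha$ is the induced subgraph $(\alpha,E\cap[\alpha]^2)$. *)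

theory Defs
  imports Main "HOL-Library.Ramsey"
begin

unbundle cardinal_syntax

text \<open>
  Cardinals are card-orders in the sense of \<^theory>\<open>HOL.BNF_Cardinal_Order_Relation\<close>, compared up
  to isomorphism by \<open>=o\<close>, \<open>\<le>o\<close>, \<open><o\<close>. An infinite cardinal \<open>\<kappa>\<close> has no greatest element, so the
  ordinals below it correspond exactly to the elements \<open>a\<close> of its field, the ordinal of \<open>a\<close> being
  the initial segment \<open>underS \<kappa> a\<close>.
\<close>

text \<open>For a card-order \<open>r\<close> this is the least cardinality of a cofinal subset, provided \<open>r\<close> is
  infinite: \<^const>\<open>cofinal\<close> asks for strictly larger elements.\<close>

definition cf :: "'a rel \<Rightarrow> 'a rel" where
  "cf r = (SOME c. Card_order c \<and>
             (\<exists>K. K \<subseteq> Field r \<and> cofinal K r \<and> |K| =o c) \<and>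
             (\<forall>K. K \<subseteq> Field r \<and> cofinal K r \<longrightarrow> c \<le>o |K| ))"

definition graph :: "'a set \<Rightarrow> 'a set set \<Rightarrow> bool" where
  "graph V E \<longleftrightarrow> E \<subseteq> [V]\<^bsup>2\<^esup>"

definition coloring_bound :: "'a set \<Rightarrow> 'a set set \<Rightarrow> 'b rel \<Rightarrow> bool" where
  "coloring_bound V E \<nu> \<longleftrightarrow>
     (\<exists>r. well_order_on V r \<and> (\<forall>x\<in>V. |{y \<in> V. {x, y} \<in> E \<and> y \<in> underS r x}| <o \<nu>))"

text \<open>The minimum may be taken over card-orders on \<open>'a set\<close>: the successor of \<open>|V|\<close> has a
  representative there and is always a bound. Lemma \<open>Col_le_iff\<close> below shows that the result is
  also minimal among card-orders on other types.\<close>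

definition Col :: "'a set \<Rightarrow> 'a set set \<Rightarrow> 'a set rel" where
  "Col V E = (SOME \<nu>. Card_order \<nu> \<and> coloring_bound V E \<nu> \<and>
                (\<forall>\<nu>' :: 'a set rel. Card_order \<nu>' \<and> coloring_bound V E \<nu>' \<longrightarrow> \<nu> \<le>o \<nu>'))"

lemma coloring_bound_mono:
  assumes "coloring_bound V E \<nu>" "\<nu> \<le>o \<nu>'"
  shows "coloring_bound V E \<nu>'"
  using assms ordLess_ordLeq_trans[OF _ assms(2)] unfolding coloring_bound_def by blast

lemma coloring_bound_cardSuc: "coloring_bound V E (cardSuc |V| )"
proof -
  obtain r where r: "well_order_on V r"
    using well_order_on by blast
  have "|{y \<in> V. {x, y} \<in> E \<and> y \<in> underS r x}| <o cardSuc |V|" for x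
  proof -
    have "|{y \<in> V. {x, y} \<in> E \<and> y \<in> underS r x}| \<le>o |V|"
      by (rule card_of_mono1) auto
    then show ?thesis
      by (rule ordLeq_ordLess_trans[OF _ cardSuc_greater[OF card_of_Card_order]])
  qed
  with r show ?thesis
    unfolding coloring_bound_def by blast
qed

lemma Col_spec:
  fixes V :: "'a set"
  shows "Card_order (Col V E) \<and> coloring_bound V E (Col V E) \<and>
    (\<forall>\<nu>' :: 'a set rel. Card_order \<nu>' \<and> coloring_bound V E \<nu>' \<longrightarrow> Col V E \<le>o \<nu>')"
proof -
  let ?R = "{\<nu> :: 'a set rel. Card_order \<nu> \<and> coloring_bound V E \<nu>}"
  have "cardSuc |V| \<in> ?R"
    using coloring_bound_cardSuc[of V E] by (simp add: cardSuc_Card_order card_of_Card_order)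
  then have "?R \<noteq> {}" by blast
  then have "\<exists>\<nu>\<in>?R. \<forall>\<nu>'\<in>?R. \<nu> \<le>o \<nu>'"
    by (rule exists_minim_Card_order) blast
  then have "\<exists>\<nu> :: 'a set rel. Card_order \<nu> \<and> coloring_bound V E \<nu> \<and>
      (\<forall>\<nu>' :: 'a set rel. Card_order \<nu>' \<and> coloring_bound V E \<nu>' \<longrightarrow> \<nu> \<le>o \<nu>')"
    by blast
  then show ?thesis
    unfolding Col_def by (rule someI_ex)
qed

lemma Col_le_iff:
  fixes V :: "'a set" and \<mu> :: "'b rel"
  assumes "Card_order \<mu>"
  shows "Col V E \<le>o \<mu> \<longleftrightarrow> coloring_bound V E \<mu>"
proof
  assume "Col V E \<le>o \<mu>"
  then show "coloring_bound V E \<mu>"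
    by (rule coloring_bound_mono[rotated]) (simp add: Col_spec)
next
  assume bound: "coloring_bound V E \<mu>"
  have suc: "Card_order (cardSuc |V| )"
    by (simp add: cardSuc_Card_order card_of_Card_order)
  show "Col V E \<le>o \<mu>"
  proof (cases "cardSuc |V| \<le>o \<mu>")
    case True
    have "Col V E \<le>o cardSuc |V|"
      using Col_spec[of V E] suc coloring_bound_cardSuc[of V E] by blast
    then show ?thesis
      using True by (rule ordLeq_transitive)
  next
    case False
    then have "\<mu> \<le>o cardSuc |V|"
      using ordLeq_total[of "cardSuc |V|" \<mu>] suc assms by (auto simp: card_order_on_def)
    then have "|Field \<mu>| \<le>o |Field (cardSuc |V| )|"
      by (rule card_of_mono2)
    then obtain f where f: "inj_on f (Field \<mu>)" "f ` Field \<mu> \<subseteq> Field (cardSuc |V| )"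
      using card_of_ordLeq[of "Field \<mu>" "Field (cardSuc |V| )"] by blast
    have "|f ` Field \<mu>| =o |Field \<mu>|"
      by (rule ordIso_symmetric, rule card_of_ordIsoI[OF inj_on_imp_bij_betw[OF f(1)]])
    then have iso: "|f ` Field \<mu>| =o \<mu>"
      by (rule ordIso_transitive[OF _ card_of_Field_ordIso[OF assms]])
    then have "coloring_bound V E |f ` Field \<mu>|"
      using coloring_bound_mono[OF bound ordIso_imp_ordLeq[OF ordIso_symmetric[OF iso]]] by simp
    then have "Col V E \<le>o |f ` Field \<mu>|"
      using Col_spec[of V E] card_of_Card_order[of "f ` Field \<mu>"] by blast
    then show ?thesis
      using iso by (rule ordLeq_ordIso_trans)
  qed
qed

lemma cf_spec:
  assumes "Card_order r" "infinite (Field r)"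
  shows "Card_order (cf r) \<and>
    (\<exists>K. K \<subseteq> Field r \<and> cofinal K r \<and> |K| =o cf r) \<and>
    (\<forall>K. K \<subseteq> Field r \<and> cofinal K r \<longrightarrow> cf r \<le>o |K| )"
proof -
  let ?R = "{ |K| | K. K \<subseteq> Field r \<and> cofinal K r}"
  have "cofinal (Field r) r"
    using infinite_Card_order_limit[OF assms] unfolding cofinal_def by blast
  then have "?R \<noteq> {}" by blast
  moreover have "\<forall>c\<in>?R. Card_order c"
    using card_of_Card_order by blast
  ultimately obtain c where c: "c \<in> ?R" "\<forall>c'\<in>?R. c \<le>o c'"
    using exists_minim_Card_order[of ?R] by blast
  then obtain K where K: "c = |K|" "K \<subseteq> Field r" "cofinal K r" by blast
  have "Card_order c \<and> (\<exists>K. K \<subseteq> Field r \<and> cofinal K r \<and> |K| =o c) \<and>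
    (\<forall>K. K \<subseteq> Field r \<and> cofinal K r \<longrightarrow> c \<le>o |K| )"
    using c K card_of_refl[of K] by (auto simp: card_of_Card_order)
  then show ?thesis
    unfolding cf_def by (rule someI)
qed

lemma regularCard_iff_cf:
  assumes "Card_order r" "infinite (Field r)"
  shows "regularCard r \<longleftrightarrow> cf r =o r"
proof
  assume reg: "regularCard r"
  obtain K where K: "K \<subseteq> Field r" "cofinal K r" "|K| =o cf r"
    using cf_spec[OF assms] by blast
  have "|K| =o r"
    using reg K(1,2) unfolding regularCard_def by blast
  with ordIso_symmetric[OF K(3)] show "cf r =o r"
    by (rule ordIso_transitive)
next
  assume cf: "cf r =o r"
  show "regularCard r"
    unfolding regularCard_def
  proof (intro allI impI)
    fix K assume K: "K \<subseteq> Field r \<and> cofinal K r"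
    then have "cf r \<le>o |K|"
      using cf_spec[OF assms] by blast
    then have "r \<le>o |K|"
      by (rule ordIso_ordLeq_trans[OF ordIso_symmetric[OF cf]])
    moreover have "|K| \<le>o r"
      using K by (intro ordLeq_ordIso_trans[OF card_of_mono1 card_of_Field_ordIso[OF assms(1)]]) blast
    ultimately show "|K| =o r"
      by (simp add: ordIso_iff_ordLeq)
  qed
qed

end

theory Submission
  imports Defs
begin

text \<open>
  If \<open>\<kappa>\<close> is at most \<open>\<mu>\<^sup>+\<close>, the order \<open>\<kappa>\<close> itself witnesses the bound, because its proper initial
  segments are smaller than \<open>\<kappa>\<close>. So let \<open>\<mu>\<^sup>+ < \<kappa>\<close>, and call a vertex heavy over a set \<open>A\<close> if it has
  at least \<open>\<mu>\<close> neighbours in \<open>A\<close>.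

  The main point is that fewer than \<open>\<kappa>\<close> vertices are heavy over a set \<open>A\<close> with \<open>|A| < \<kappa>\<close>
  (\<open>card_heavy_over_less\<close>). In an order witnessing coloring number at most \<open>\<mu>\<close>, a heavy vertex has
  fewer than \<open>\<mu>\<close> neighbours before it, hence precedes one of its neighbours in \<open>A\<close>; and
  each element of \<open>A\<close> has fewer than \<open>\<mu>\<close> neighbours before it, where \<open>\<mu> \<le> |A|\<close> as soon as some vertex
  is heavy. So at most \<open>|A|\<close> vertices are heavy (\<open>card_heavy_le\<close>). If \<open>|A|\<^sup>+ < \<kappa>\<close> this applies in \<open>\<G>\<close>: otherwise \<open>A\<close> and some
  \<open>|A|\<^sup>+\<close> heavy vertices would lie together in an initial segment \<open>\<G>\<^sub>\<alpha>\<close>. There remains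
  \<open>\<kappa> = \<lambda>\<^sup>+\<close> with \<open>\<lambda> = |A|\<close>. Then \<open>cf(\<lambda>) \<noteq> cf(\<mu>)\<close>: by the hypothesis on
  \<open>\<kappa>\<close> if \<open>\<lambda>\<close> is singular, and because \<open>cf(\<mu>) \<le> \<mu> < \<lambda> = cf(\<lambda>)\<close> if \<open>\<lambda>\<close> is regular. Order \<open>A\<close> in type \<open>\<lambda>\<close>; a vertex heavy over \<open>A\<close> is heavy over one of the
  \<open>\<lambda>\<close> proper initial segments (\<open>large_set_has_large_segment\<close>), and each of them has at most
  \<open>\<lambda>\<close> heavy vertices by the first case.

  Since \<open>\<kappa>\<close> is regular and uncountable, there are then unboundedly many points \<open>a\<close> such that every
  vertex heavy over the predecessors of some \<open>y < a\<close> is itself below \<open>a\<close>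
  (\<open>closure_points_unbounded\<close>). For a vertex at or above such a point \<open>a\<close>, its
  neighbours below \<open>a\<close> form a set all of whose proper initial segments are smaller than \<open>\<mu>\<close>, so there are at
  most \<open>\<mu>\<close> of them (\<open>card_nbrs_below_closure_points\<close>). This loss from \<open>< \<mu>\<close> to \<open>\<le> \<mu>\<close> is where
  \<open>\<mu>\<^sup>+\<close> comes from. The closure points cut \<open>\<kappa>\<close> into bounded blocks; listing the blocks
  one after the other and each block in an order for an initial segment
  containing it, a vertex has at most \<open>\<mu>\<close> neighbours in earlier blocks and fewer than \<open>\<mu>\<close> before it
  in its own block.
\<close>

section \<open>Well-orders and cofinalities\<close>

lemma Well_order_underS_cases:
  assumes "Well_order r" "a \<in> Field r" "b \<in> Field r"
  shows "a \<in> underS r b \<or> (b, a) \<in> r"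
  using assms wo_rel.TOTALS[of r] wo_rel.REFL[of r]
  unfolding underS_def wo_rel_def refl_on_def by blast

lemma Well_order_underS_trans:
  assumes "Well_order r" "a \<in> underS r b" "(b, c) \<in> r"
  shows "a \<in> underS r c"
  using assms underS_incr[of r b c] wo_rel.TRANS[of r] wo_rel.ANTISYM[of r]
  unfolding wo_rel_def by blast

lemma not_underS_converse:
  assumes "Well_order r" "a \<in> underS r b"
  shows "(b, a) \<notin> r"
  using assms wo_rel.ANTISYM[of r] unfolding wo_rel_def underS_def antisym_def by blast

lemma cofinal_iff_underS: "cofinal K r \<longleftrightarrow> (\<forall>a\<in>Field r. \<exists>b\<in>K. a \<in> underS r b)"
  unfolding cofinal_def underS_def by blast

lemma regular_small_set_bounded:
  assumes "Card_order \<kappa>" "infinite (Field \<kappa>)" "regularCard \<kappa>" "S \<subseteq> Field \<kappa>" "|S| <o \<kappa>"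
  obtains b where "b \<in> Field \<kappa>" "S \<subseteq> underS \<kappa> b"
proof -
  have wo: "Well_order \<kappa>"
    using assms(1) by (simp add: card_order_on_def)
  have "\<not> cofinal S \<kappa>"
    using assms(3-5) not_ordLess_ordIso unfolding regularCard_def by blast
  then obtain a where a: "a \<in> Field \<kappa>" "\<forall>s\<in>S. a \<notin> underS \<kappa> s"
    unfolding cofinal_iff_underS by blast
  obtain b where b: "b \<in> Field \<kappa>" "a \<in> underS \<kappa> b"
    using infinite_Card_order_limit[OF assms(1,2) a(1)] unfolding underS_def by blast
  have "s \<in> underS \<kappa> b" if "s \<in> S" for s
  proof -
    have "s \<in> Field \<kappa>"
      using that assms(4) by blast
    then have "(s, a) \<in> \<kappa>"
      using Well_order_underS_cases[OF wo a(1)] a(2) that by blast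
    then show ?thesis
      using b wo by (metis Well_order_underS_cases Well_order_underS_trans \<open>s \<in> Field \<kappa>\<close>
          not_underS_converse wo_rel.TRANS wo_rel_def underS_E transD)
  qed
  then show thesis
    using that[OF b(1)] by blast
qed

text \<open>The order type of \<open>X\<close>, not only its cardinality, is bounded: were it larger than \<open>\<mu>\<close>, some
  proper initial segment of \<open>X\<close> would have order type \<open>\<mu>\<close>. The order type is what determines
  cofinalities below.\<close>

lemma Restr_ordLeq_of_small_segments:
  assumes wo: "Well_order r" and X: "X \<subseteq> Field r" and \<mu>: "Card_order \<mu>"
    and small: "\<And>x. x \<in> X \<Longrightarrow> |{y \<in> X. y \<in> underS r x}| <o \<mu>"
  shows "Restr r X \<le>o \<mu>"
proof -
  have wo\<mu>: "Well_order \<mu>"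
    using \<mu> by (simp add: card_order_on_def)
  have wX: "well_order_on X (Restr r X)"
    using well_order_on_Restr[OF wo X] .
  then have F: "Field (Restr r X) = X" and woX: "Well_order (Restr r X)"
    using well_order_on_Field[OF wX] by auto
  have False if less: "\<mu> <o Restr r X"
  proof -
    obtain x where x: "x \<in> X" "\<mu> =o Restr (Restr r X) (underS (Restr r X) x)"
      using less ordLess_iff_ordIso_Restr[OF woX wo\<mu>] unfolding F by blast
    have "Field (Restr (Restr r X) (underS (Restr r X) x)) \<subseteq> {y \<in> X. y \<in> underS r x}"
      unfolding Field_def underS_def by blast
    then have "|Field \<mu>| \<le>o |{y \<in> X. y \<in> underS r x}|"
      using ordIso_ordLeq_trans[OF card_of_cong[OF x(2)] card_of_mono1] by blast
    then have "\<mu> \<le>o |{y \<in> X. y \<in> underS r x}|"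
      using ordIso_ordLeq_trans[OF ordIso_symmetric[OF card_of_Field_ordIso[OF \<mu>]]] by blast
    with small[OF x(1)] show False
      using not_ordLess_ordLeq by blast
  qed
  then show ?thesis
    using ordLess_or_ordLeq[OF wo\<mu> woX] by blast
qed

lemma card_ordLeq_of_small_segments:
  assumes "Well_order r" "X \<subseteq> Field r" "Card_order \<mu>"
    and "\<And>x. x \<in> X \<Longrightarrow> |{y \<in> X. y \<in> underS r x}| <o \<mu>"
  shows "|X| \<le>o \<mu>"
  using ordLeq_transitive[OF card_of_least[OF well_order_on_Restr] Restr_ordLeq_of_small_segments]
    assms by blast

lemma cf_le_cofinal:
  assumes "Card_order r" "infinite (Field r)" "K \<subseteq> Field r" "cofinal K r"
  shows "cf r \<le>o |K|"
  using cf_spec[OF assms(1,2)] assms(3,4) by blast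

text \<open>Cofinal sets are transferred both ways along the isomorphism from \<open>\<mu>\<close> to \<open>X\<close>. A cofinal subset
  of \<open>l\<close> need not lie in \<open>X\<close>, so its elements are first moved up to elements of \<open>X\<close>.\<close>

lemma cf_ordIso_of_cofinal_copy:
  assumes l: "Card_order l" "infinite (Field l)" and \<mu>: "Card_order \<mu>" "infinite (Field \<mu>)"
    and X: "X \<subseteq> Field l" "cofinal X l" "Restr l X =o \<mu>"
  shows "cf l =o cf \<mu>"
proof -
  have wol: "Well_order l" and wo\<mu>: "Well_order \<mu>"
    using l(1) \<mu>(1) by (simp_all add: card_order_on_def)
  have F: "Field (Restr l X) = X"
    using well_order_on_Field[OF well_order_on_Restr[OF wol X(1)]] by blast
  obtain f where f: "iso \<mu> (Restr l X) f"
    using ordIso_symmetric[OF X(3)] unfolding ordIso_def by blast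
  then have bij: "bij_betw f (Field \<mu>) X"
    and emb: "\<And>a b. a \<in> Field \<mu> \<Longrightarrow> b \<in> Field \<mu> \<Longrightarrow> (a, b) \<in> \<mu> \<longleftrightarrow> (f a, f b) \<in> Restr l X"
    using f unfolding iso_iff2 F by auto
  have lt: "a \<in> underS \<mu> b \<longleftrightarrow> f a \<in> underS l (f b)" if "a \<in> Field \<mu>" "b \<in> Field \<mu>" for a b
    using emb[OF that] bij that unfolding underS_def bij_betw_def inj_on_def by auto
  have fX: "f a \<in> Field l" if "a \<in> Field \<mu>" for a
    using bij that X(1) unfolding bij_betw_def by blast
  obtain M where M: "M \<subseteq> Field \<mu>" "cofinal M \<mu>" "|M| =o cf \<mu>"
    using cf_spec[OF \<mu>] by blast
  have "cofinal (f ` M) l"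
    unfolding cofinal_iff_underS
  proof
    fix a assume "a \<in> Field l"
    then obtain x where x: "x \<in> X" "a \<in> underS l x"
      using X(2) unfolding cofinal_iff_underS by blast
    then obtain y where y: "y \<in> Field \<mu>" "x = f y"
      using bij unfolding bij_betw_def by blast
    then obtain m where m: "m \<in> M" "y \<in> underS \<mu> m"
      using M(2) unfolding cofinal_iff_underS by blast
    then have "f y \<in> underS l (f m)"
      using lt y(1) M(1) by blast
    then have "a \<in> underS l (f m)"
      using Well_order_underS_trans[OF wol x(2)] y(2) unfolding underS_def by blast
    then show "\<exists>b\<in>f ` M. a \<in> underS l b"
      using m(1) by blast
  qed
  then have "cf l \<le>o |f ` M|"
    using cf_le_cofinal[OF l] M(1) fX by blast
  then have "cf l \<le>o |M|"
    using card_of_image ordLeq_transitive by blast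
  then have le: "cf l \<le>o cf \<mu>"
    using M(3) ordLeq_ordIso_trans by blast
  obtain K where K: "K \<subseteq> Field l" "cofinal K l" "|K| =o cf l"
    using cf_spec[OF l] by blast
  have "\<exists>y\<in>Field \<mu>. k \<in> underS l (f y)" if "k \<in> K" for k
    using X(2) K(1) that bij unfolding cofinal_iff_underS bij_betw_def by blast
  then obtain g where g: "\<And>k. k \<in> K \<Longrightarrow> g k \<in> Field \<mu> \<and> k \<in> underS l (f (g k))"
    by metis
  have "cofinal (g ` K) \<mu>"
    unfolding cofinal_iff_underS
  proof
    fix y assume y: "y \<in> Field \<mu>"
    then obtain k where k: "k \<in> K" "f y \<in> underS l k"
      using K(2) fX unfolding cofinal_iff_underS by blast
    then have "f y \<in> underS l (f (g k))"
      using Well_order_underS_trans[OF wol k(2)] g[OF k(1)] unfolding underS_def by blast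
    then show "\<exists>b\<in>g ` K. y \<in> underS \<mu> b"
      using lt[OF y] g[OF k(1)] k(1) by blast
  qed
  then have "cf \<mu> \<le>o |g ` K|"
    using cf_le_cofinal[OF \<mu>] g by blast
  then have "cf \<mu> \<le>o |K|"
    using card_of_image ordLeq_transitive by blast
  then have "cf \<mu> \<le>o cf l"
    using K(3) ordLeq_ordIso_trans by blast
  with le show ?thesis
    by (simp add: ordIso_iff_ordLeq)
qed

text \<open>If every set that \<open>l\<close> cuts off from \<open>X\<close> were smaller than \<open>\<mu>\<close>, then \<open>X\<close> would have order
  type exactly \<open>\<mu>\<close> and, not being bounded, would be cofinal in \<open>l\<close>. This would make the two
  cofinalities equal.\<close>

lemma large_set_has_large_segment:
  assumes l: "Card_order l" "infinite (Field l)" and \<mu>: "Card_order \<mu>" "infinite (Field \<mu>)"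
    and cf: "\<not> cf l =o cf \<mu>" and X: "X \<subseteq> Field l" "\<mu> \<le>o |X|"
  shows "\<exists>k\<in>Field l. \<mu> \<le>o |{y \<in> X. y \<in> underS l k}|"
proof (rule ccontr)
  assume none: "\<not> ?thesis"
  have wol: "Well_order l" and wo\<mu>: "Well_order \<mu>"
    using l(1) \<mu>(1) by (simp_all add: card_order_on_def)
  have small: "|{y \<in> X. y \<in> underS l a}| <o \<mu>" if a: "a \<in> Field l" for a
    using none a ordLess_or_ordLeq[OF card_of_Well_order wo\<mu>] by blast
  have "Restr l X \<le>o \<mu>"
    using Restr_ordLeq_of_small_segments[OF wol X(1) \<mu>(1)] small X(1) by blast
  moreover have "\<mu> \<le>o Restr l X"
    using ordLeq_transitive[OF X(2) card_of_least[OF well_order_on_Restr[OF wol X(1)]]] .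
  ultimately have iso: "Restr l X =o \<mu>"
    by (simp add: ordIso_iff_ordLeq)
  have "cofinal X l"
    unfolding cofinal_iff_underS
  proof (rule ccontr)
    assume "\<not> (\<forall>a\<in>Field l. \<exists>b\<in>X. a \<in> underS l b)"
    then obtain a where a: "a \<in> Field l" "\<forall>x\<in>X. a \<notin> underS l x"
      by blast
    obtain k where k: "k \<in> Field l" "a \<in> underS l k"
      using infinite_Card_order_limit[OF l a(1)] unfolding underS_def by blast
    have "x \<in> underS l k" if x: "x \<in> X" for x
    proof (rule ccontr)
      assume "x \<notin> underS l k"
      then have "(k, x) \<in> l"
        using Well_order_underS_cases[OF wol _ k(1)] x X(1) by blast
      then show False
        using Well_order_underS_trans[OF wol k(2)] a(2) x by blast
    qed
    then have "{y \<in> X. y \<in> underS l k} = X"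
      by blast
    then show False
      using small[OF k(1)] X(2) not_ordLess_ordLeq by metis
  qed
  with cf_ordIso_of_cofinal_copy[OF l \<mu> X(1) _ iso] cf show False
    by blast
qed

section \<open>Vertices with many neighbours in a small set\<close>

definition heavy :: "'a set set \<Rightarrow> 'b rel \<Rightarrow> 'a set \<Rightarrow> 'a set \<Rightarrow> 'a set" where
  "heavy E \<mu> V A = {x \<in> V. \<mu> \<le>o |{y \<in> A. {x, y} \<in> E}|}"

lemma heavy_mono: "A \<subseteq> A' \<Longrightarrow> heavy E \<mu> V A \<subseteq> heavy E \<mu> V A'"
proof -
  assume "A \<subseteq> A'"
  then have "|{y \<in> A. {x, y} \<in> E}| \<le>o |{y \<in> A'. {x, y} \<in> E}|" for x
    by (intro card_of_mono1) blast
  then show ?thesis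
    unfolding heavy_def using ordLeq_transitive by blast
qed

lemma heavy_empty_or_large: "heavy E \<mu> V A = {} \<or> \<mu> \<le>o |A|"
proof -
  have "\<mu> \<le>o |A|" if "\<mu> \<le>o |{y \<in> A. {x, y} \<in> E}|" for x
    using ordLeq_transitive[OF that card_of_mono1] by auto
  then show ?thesis
    unfolding heavy_def by blast
qed

text \<open>A heavy vertex \<open>x\<close> cannot come after all its neighbours in \<open>A\<close>, since it has fewer than \<open>\<mu>\<close>
  neighbours before it. So \<open>x\<close> is one of the fewer than \<open>\<mu>\<close> earlier neighbours of
  some \<open>a \<in> A\<close>, and there are at most \<open>|A| \<cdot> \<mu> = |A|\<close> such vertices.\<close>

lemma card_heavy_le:
  assumes \<mu>: "Card_order \<mu>" "infinite (Field \<mu>)" and G: "graph V E" and A: "A \<subseteq> V"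
    and bound: "coloring_bound V E \<mu>"
  shows "|heavy E \<mu> V A| \<le>o |A|"
proof (cases "heavy E \<mu> V A = {}")
  case True
  then show ?thesis
    by (simp add: card_of_empty)
next
  case False
  then have large: "\<mu> \<le>o |A|"
    using heavy_empty_or_large[of E \<mu> V A] by simp
  then have inf: "infinite A"
    using \<mu>(2) card_of_ordLeq_finite[OF card_of_mono2[OF large]] unfolding Field_card_of by blast
  obtain r where r: "well_order_on V r"
    and small: "\<And>x. x \<in> V \<Longrightarrow> |{y \<in> V. {x, y} \<in> E \<and> y \<in> underS r x}| <o \<mu>"
    using bound unfolding coloring_bound_def by blast
  have wo: "Well_order r" and F: "Field r = V"
    using well_order_on_Well_order[OF r] by auto
  have "heavy E \<mu> V A \<subseteq> (\<Union>a\<in>A. {y \<in> V. {a, y} \<in> E \<and> y \<in> underS r a})"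
  proof
    fix x assume "x \<in> heavy E \<mu> V A"
    then have x: "x \<in> V" "\<mu> \<le>o |{y \<in> A. {x, y} \<in> E}|"
      unfolding heavy_def by auto
    have "\<not> {y \<in> A. {x, y} \<in> E} \<subseteq> {y \<in> V. {x, y} \<in> E \<and> y \<in> underS r x}"
      using ordLeq_transitive[OF x(2) card_of_mono1] small[OF x(1)] not_ordLess_ordLeq by blast
    then obtain a where a: "a \<in> A" "{x, a} \<in> E" "a \<notin> underS r x"
      using A by blast
    then have "x \<noteq> a"
      using G unfolding graph_def nsets_def by fastforce
    moreover have "(x, a) \<in> r"
      using Well_order_underS_cases[OF wo, of a x] a A x(1) F by blast
    ultimately have "x \<in> underS r a"
      unfolding underS_def by blast
    then show "x \<in> (\<Union>a\<in>A. {y \<in> V. {a, y} \<in> E \<and> y \<in> underS r a})"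
      using a x(1) by (auto simp: insert_commute)
  qed
  then have "|heavy E \<mu> V A| \<le>o |\<Union>a\<in>A. {y \<in> V. {a, y} \<in> E \<and> y \<in> underS r a}|"
    by (rule card_of_mono1)
  also have "|\<Union>a\<in>A. {y \<in> V. {a, y} \<in> E \<and> y \<in> underS r a}| \<le>o |A|"
  proof (rule card_of_UNION_ordLeq_infinite[OF inf ordIso_imp_ordLeq[OF card_of_refl]], rule ballI)
    fix a assume "a \<in> A"
    then show "|{y \<in> V. {a, y} \<in> E \<and> y \<in> underS r a}| \<le>o |A|"
      using ordLeq_transitive[OF ordLess_imp_ordLeq[OF small] large] A by blast
  qed
  finally show ?thesis .
qed

text \<open>The nontrivial case, in which \<open>\<mu>\<^sup>+ < \<kappa>\<close>.\<close>

locale locally_colorable_graph =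
  fixes \<kappa> :: "'a rel" and \<mu> :: "'b rel" and E :: "'a set set"
  assumes \<mu>: "Card_order \<mu>" "infinite (Field \<mu>)"
    and \<kappa>: "Card_order \<kappa>" "regularCard \<kappa>"
    and gap: "cardSuc \<mu> <o \<kappa>"
    and G: "graph (Field \<kappa>) E"
    and local_bound: "\<And>b. b \<in> Field \<kappa> \<Longrightarrow>
      coloring_bound (underS \<kappa> b) (E \<inter> [underS \<kappa> b]\<^bsup>2\<^esup>) \<mu>"
begin

lemma wo\<kappa>: "Well_order \<kappa>" and wo\<mu>: "Well_order \<mu>"
  using \<kappa>(1) \<mu>(1) by (simp_all add: card_order_on_def)

lemma \<mu>_less_\<kappa>: "\<mu> <o \<kappa>"
  using ordLess_transitive[OF cardSuc_greater[OF \<mu>(1)] gap] .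

lemma infinite_\<kappa>: "infinite (Field \<kappa>)"
  using \<mu>(2) card_of_ordLeq_finite[OF card_of_mono2[OF ordLess_imp_ordLeq[OF \<mu>_less_\<kappa>]]] by blast

abbreviation heavy_over :: "'a set \<Rightarrow> 'a set" where
  "heavy_over A \<equiv> heavy E \<mu> (Field \<kappa>) A"

lemma small_set_bounded:
  assumes "S \<subseteq> Field \<kappa>" "|S| <o \<kappa>"
  obtains b where "b \<in> Field \<kappa>" "S \<subseteq> underS \<kappa> b"
  using regular_small_set_bounded[OF \<kappa>(1) infinite_\<kappa> \<kappa>(2) assms] .

text \<open>The set \<open>A\<close> together with \<open>|A|\<^sup>+\<close> vertices heavy over it would have size below \<open>\<kappa>\<close>, hence by
  regularity be contained in some \<open>\<G>\<^sub>\<alpha>\<close>, contradicting \<open>card_heavy_le\<close> there.\<close>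

lemma card_heavy_over_le:
  assumes A: "A \<subseteq> Field \<kappa>" and gapA: "cardSuc |A| <o \<kappa>"
  shows "|heavy_over A| \<le>o |A|"
proof (rule ccontr)
  let ?H = "heavy_over A"
  assume "\<not> |?H| \<le>o |A|"
  then have "|A| <o |?H|"
    using not_ordLeq_iff_ordLess[OF card_of_Well_order card_of_Well_order] by blast
  then have "cardSuc |A| \<le>o |?H|"
    by (rule cardSuc_least[OF card_of_Card_order card_of_Card_order])
  then have "|Field (cardSuc |A| )| \<le>o |?H|"
    using ordIso_ordLeq_trans[OF card_of_Field_ordIso[OF cardSuc_Card_order[OF card_of_Card_order]]]
    by blast
  then obtain B where B: "B \<subseteq> ?H" "|Field (cardSuc |A| )| =o |B|"
    using iffD1[OF internalize_card_of_ordLeq2] by blast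
  have Biso: "cardSuc |A| =o |B|"
    using ordIso_transitive[OF ordIso_symmetric[OF card_of_Field_ordIso[OF
        cardSuc_Card_order[OF card_of_Card_order]]] B(2)] .
  have "|B| <o \<kappa>"
    using ordIso_ordLess_trans[OF ordIso_symmetric[OF Biso] gapA] .
  moreover have "|A| <o \<kappa>"
    using ordLess_transitive[OF cardSuc_greater[OF card_of_Card_order] gapA] .
  ultimately have "|A \<union> B| <o \<kappa>"
    using card_of_Un_ordLess_infinite_Field[OF infinite_\<kappa> \<kappa>(1)] by blast
  moreover have "A \<union> B \<subseteq> Field \<kappa>"
    using A B(1) unfolding heavy_def by blast
  ultimately obtain b where b: "b \<in> Field \<kappa>" "A \<union> B \<subseteq> underS \<kappa> b"
    using small_set_bounded by blast
  let ?U = "underS \<kappa> b"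
  have "B \<subseteq> heavy (E \<inter> [?U]\<^bsup>2\<^esup>) \<mu> ?U A"
  proof
    fix x assume x: "x \<in> B"
    have "{x, y} \<in> [?U]\<^bsup>2\<^esup>" if "y \<in> A" "{x, y} \<in> E" for y
      using that x b(2) G unfolding graph_def nsets_def by blast
    then have "{y \<in> A. {x, y} \<in> E \<inter> [?U]\<^bsup>2\<^esup>} = {y \<in> A. {x, y} \<in> E}"
      by blast
    then show "x \<in> heavy (E \<inter> [?U]\<^bsup>2\<^esup>) \<mu> ?U A"
      using x b(2) B(1) unfolding heavy_def by auto
  qed
  then have "|B| \<le>o |heavy (E \<inter> [?U]\<^bsup>2\<^esup>) \<mu> ?U A|"
    by (rule card_of_mono1)
  also have "|heavy (E \<inter> [?U]\<^bsup>2\<^esup>) \<mu> ?U A| \<le>o |A|"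
    using b(2) by (intro card_heavy_le[OF \<mu> _ _ local_bound[OF b(1)]]) (auto simp: graph_def)
  finally have "cardSuc |A| \<le>o |A|"
    using ordIso_ordLeq_trans[OF Biso] by blast
  then show False
    using cardSuc_greater[OF card_of_Card_order] not_ordLess_ordLeq by blast
qed

text \<open>The hypothesis on successors of singular cardinals serves the case \<open>\<kappa> = |A|\<^sup>+\<close>: together with
  \<open>\<mu> < |A|\<close> it gives \<open>cf |A| \<noteq> cf \<mu>\<close>, so a vertex heavy over \<open>A\<close> is heavy over a proper initial
  segment of \<open>A\<close> in the well-order \<open>|A|\<close>. There are \<open>|A|\<close> of these, all small enough for
  \<open>card_heavy_over_le\<close>.\<close>

lemma card_heavy_over_less:
  assumes excl: "\<not> (\<exists>l :: 'a rel. Card_order l \<and> infinite (Field l) \<and> \<not> regularCard l \<and>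
              cf l =o cf \<mu> \<and> \<kappa> =o cardSuc l)"
    and A: "A \<subseteq> Field \<kappa>" "|A| <o \<kappa>"
  shows "|heavy_over A| <o \<kappa>"
proof (cases "cardSuc |A| <o \<kappa>")
  case True
  then show ?thesis
    using ordLeq_ordLess_trans[OF card_heavy_over_le[OF A(1)] A(2)] by blast
next
  case False
  let ?l = "|A|"
  have suc: "\<kappa> =o cardSuc ?l"
    using False cardSuc_least[OF card_of_Card_order \<kappa>(1) A(2)]
    by (metis ordIso_symmetric ordLeq_iff_ordLess_or_ordIso)
  have "\<mu> <o ?l"
  proof -
    have "cardSuc \<mu> <o cardSuc ?l"
      using ordLess_ordIso_trans[OF gap suc] .
    then have "cardSuc \<mu> \<le>o ?l"
      using cardSuc_ordLeq_ordLess[OF card_of_Card_order[of A] cardSuc_Card_order[OF \<mu>(1)]] by blast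
    then show ?thesis
      using ordLess_ordLeq_trans[OF cardSuc_greater[OF \<mu>(1)]] by blast
  qed
  then have inf: "infinite A"
    using \<mu>(2) card_of_mono2[OF ordLess_imp_ordLeq] card_of_ordLeq_finite
    by (metis Field_card_of)
  have l: "Card_order ?l" "infinite (Field ?l)"
    using inf card_of_Card_order by (simp_all add: Field_card_of)
  have cf: "\<not> cf ?l =o cf \<mu>"
  proof (cases "regularCard ?l")
    case True
    obtain M where M: "M \<subseteq> Field \<mu>" "|M| =o cf \<mu>"
      using cf_spec[OF \<mu>] by blast
    have "cf \<mu> \<le>o \<mu>"
      using ordIso_ordLeq_trans[OF ordIso_symmetric[OF M(2)]] card_of_mono1[OF M(1)]
        card_of_Field_ordIso[OF \<mu>(1)] ordLeq_ordIso_trans by blast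
    then have "cf \<mu> <o ?l"
      using \<open>\<mu> <o ?l\<close> ordLeq_ordLess_trans by blast
    moreover have "cf ?l =o ?l"
      using True regularCard_iff_cf[OF l] by blast
    ultimately show ?thesis
      by (meson not_ordLess_ordIso ordIso_symmetric ordIso_transitive)
  next
    case False
    then show ?thesis
      using excl l suc by blast
  qed
  have segment: "|heavy_over (underS ?l k)| \<le>o ?l" if k: "k \<in> A" for k
  proof -
    have less: "|underS ?l k| <o ?l"
      using card_of_underS[OF l(1)] k by (auto simp: Field_card_of)
    then have "cardSuc |underS ?l k| \<le>o ?l"
      by (rule cardSuc_least[OF card_of_Card_order card_of_Card_order])
    then have "cardSuc |underS ?l k| <o \<kappa>"
      using A(2) ordLeq_ordLess_trans by blast
    moreover have "underS ?l k \<subseteq> Field \<kappa>"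
      using A(1) underS_Field[of _ ?l k] unfolding Field_card_of by blast
    ultimately show ?thesis
      using card_heavy_over_le ordLess_imp_ordLeq[OF less] ordLeq_transitive by blast
  qed
  have "heavy_over A \<subseteq> (\<Union>k\<in>A. heavy_over (underS ?l k))"
  proof
    fix x assume "x \<in> heavy_over A"
    then have x: "x \<in> Field \<kappa>" "\<mu> \<le>o |{y \<in> A. {x, y} \<in> E}|"
      unfolding heavy_def by auto
    have "{y \<in> A. {x, y} \<in> E} \<subseteq> Field ?l"
      unfolding Field_card_of by blast
    from large_set_has_large_segment[OF l \<mu> cf this x(2)] obtain k where k: "k \<in> A"
      "\<mu> \<le>o |{y \<in> {y \<in> A. {x, y} \<in> E}. y \<in> underS ?l k}|"
      unfolding Field_card_of by blast
    have "{y \<in> {y \<in> A. {x, y} \<in> E}. y \<in> underS ?l k} \<subseteq> {y \<in> underS ?l k. {x, y} \<in> E}"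
      by blast
    then have "x \<in> heavy_over (underS ?l k)"
      using x(1) ordLeq_transitive[OF k(2) card_of_mono1] unfolding heavy_def by blast
    with k(1) show "x \<in> (\<Union>k\<in>A. heavy_over (underS ?l k))"
      by blast
  qed
  then have "|heavy_over A| \<le>o |\<Union>k\<in>A. heavy_over (underS ?l k)|"
    by (rule card_of_mono1)
  also have "|\<Union>k\<in>A. heavy_over (underS ?l k)| \<le>o ?l"
    using segment by (intro card_of_UNION_ordLeq_infinite[OF inf ordIso_imp_ordLeq[OF card_of_refl]])
      blast
  finally show ?thesis
    using A(2) ordLeq_ordLess_trans by blast
qed

section \<open>Gluing the orders of the blocks\<close>

definition closure_points :: "'a set" where
  "closure_points = {a \<in> Field \<kappa>. \<forall>y\<in>underS \<kappa> a. heavy_over (underS \<kappa> y) \<subseteq> underS \<kappa> a}"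

text \<open>Iterate \<open>\<omega>\<close> times a function bounding the heavy vertices over each initial segment, starting
  at \<open>x\<close>. The supremum exists because \<open>\<kappa>\<close> is regular and larger than \<open>\<mu> \<ge> \<omega>\<close>, and it is a closure
  point.\<close>

lemma closure_points_unbounded:
  assumes heavy: "\<And>y. y \<in> Field \<kappa> \<Longrightarrow> |heavy_over (underS \<kappa> y)| <o \<kappa>" and x: "x \<in> Field \<kappa>"
  shows "\<exists>a\<in>closure_points. x \<in> underS \<kappa> a"
proof -
  have "\<exists>b\<in>Field \<kappa>. insert y (heavy_over (underS \<kappa> y)) \<subseteq> underS \<kappa> b" if y: "y \<in> Field \<kappa>" for y
  proof -
    have "|{y}| <o \<kappa>"
      using infinite_\<kappa> by (intro finite_ordLess_infinite[OF card_of_Well_order wo\<kappa>])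
        (simp_all add: Field_card_of)
    then have "|{y} \<union> heavy_over (underS \<kappa> y)| <o \<kappa>"
      using card_of_Un_ordLess_infinite_Field[OF infinite_\<kappa> \<kappa>(1)] heavy[OF y] by blast
    moreover have "{y} \<union> heavy_over (underS \<kappa> y) \<subseteq> Field \<kappa>"
      using y unfolding heavy_def by blast
    ultimately show ?thesis
      using small_set_bounded by (metis insert_is_Un)
  qed
  then obtain F where F: "\<And>y. y \<in> Field \<kappa> \<Longrightarrow>
      F y \<in> Field \<kappa> \<and> insert y (heavy_over (underS \<kappa> y)) \<subseteq> underS \<kappa> (F y)"
    by metis
  define g where "g n = (F ^^ n) x" for n
  have g0: "g 0 = x" and gSuc: "g (Suc n) = F (g n)" for n
    unfolding g_def by simp_all
  have gF: "g n \<in> Field \<kappa>" for n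
    by (induction n) (use x F g0 gSuc in auto)
  have "|range g| \<le>o |Field \<mu>|"
    using ordLeq_transitive[OF card_of_image] \<mu>(2) infinite_iff_card_of_nat by blast
  then have "|range g| <o \<kappa>"
    using card_of_Field_ordIso[OF \<mu>(1)] \<mu>_less_\<kappa> ordLeq_ordIso_trans ordLeq_ordLess_trans by blast
  moreover have "range g \<subseteq> Field \<kappa>"
    using gF by blast
  ultimately obtain b where b: "b \<in> Field \<kappa>" "range g \<subseteq> underS \<kappa> b"
    using small_set_bounded by blast
  \<comment> \<open>The sequence \<open>g\<close> is strictly increasing, so its least strict upper bound is its supremum:
    anything below it is at most some \<open>g n\<close>.\<close>
  let ?B = "{b \<in> Field \<kappa>. range g \<subseteq> underS \<kappa> b}"
  define a where "a = wo_rel.minim \<kappa> ?B"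
  have wor: "wo_rel \<kappa>"
    using wo\<kappa> by (simp add: wo_rel_def)
  have B: "?B \<subseteq> Field \<kappa>" "?B \<noteq> {}"
    using b by auto
  have a: "a \<in> Field \<kappa>" "range g \<subseteq> underS \<kappa> a"
    using wo_rel.minim_in[OF wor B] unfolding a_def by auto
  have "heavy_over (underS \<kappa> y) \<subseteq> underS \<kappa> a" if y: "y \<in> underS \<kappa> a" for y
  proof -
    have yF: "y \<in> Field \<kappa>"
      using underS_Field[OF y] .
    have "y \<notin> ?B"
      using wo_rel.minim_least[OF wor B(1)] not_underS_converse[OF wo\<kappa> y] unfolding a_def by blast
    then obtain n where "g n \<notin> underS \<kappa> y"
      using yF by blast
    then have "(y, g n) \<in> \<kappa>"
      using Well_order_underS_cases[OF wo\<kappa> gF yF] by blast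
    then have "underS \<kappa> y \<subseteq> underS \<kappa> (g n)"
      using Well_order_underS_trans[OF wo\<kappa>] by blast
    then have "heavy_over (underS \<kappa> y) \<subseteq> heavy_over (underS \<kappa> (g n))"
      by (rule heavy_mono)
    also have "\<dots> \<subseteq> underS \<kappa> (g (Suc n))"
      using F[OF gF] unfolding gSuc by blast
    also have "\<dots> \<subseteq> underS \<kappa> a"
      using Well_order_underS_trans[OF wo\<kappa>] a(2) unfolding underS_def by blast
    finally show ?thesis .
  qed
  then have "a \<in> closure_points"
    using a(1) unfolding closure_points_def by blast
  moreover have "x \<in> underS \<kappa> a"
    using a(2) g0 by blast
  ultimately show ?thesis
    by blast
qed

text \<open>For a neighbour \<open>y\<close> of \<open>x\<close> with a closure point between them, \<open>x\<close> is not heavy over the vertices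
  below \<open>y\<close>. So all proper initial segments of the set of these neighbours are smaller than \<open>\<mu>\<close>.\<close>

lemma card_nbrs_below_closure_points:
  assumes x: "x \<in> Field \<kappa>"
  shows "|{y \<in> Field \<kappa>. {x, y} \<in> E \<and> (\<exists>a\<in>closure_points. y \<in> underS \<kappa> a \<and> (a, x) \<in> \<kappa>)}| \<le>o \<mu>"
    (is "|?N| \<le>o \<mu>")
proof (rule card_ordLeq_of_small_segments[OF wo\<kappa> _ \<mu>(1)])
  fix y assume "y \<in> ?N"
  then obtain a where a: "a \<in> closure_points" "y \<in> underS \<kappa> a" "(a, x) \<in> \<kappa>"
    by blast
  then have "x \<notin> heavy_over (underS \<kappa> y)"
    using not_underS_converse[OF wo\<kappa>] unfolding closure_points_def by blast
  then have "|{z \<in> underS \<kappa> y. {x, z} \<in> E}| <o \<mu>"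
    using x ordLess_or_ordLeq[OF card_of_Well_order wo\<mu>] unfolding heavy_def by blast
  moreover have "{z \<in> ?N. z \<in> underS \<kappa> y} \<subseteq> {z \<in> underS \<kappa> y. {x, z} \<in> E}"
    by blast
  ultimately show "|{z \<in> ?N. z \<in> underS \<kappa> y}| <o \<mu>"
    using card_of_mono1 ordLeq_ordLess_trans by blast
qed blast

end

text \<open>The block of \<open>x\<close> is the fibre of \<open>m\<close> through \<open>x\<close>. The orders \<open>W\<close> are given on supersets \<open>U\<close> of the
  fibres so that they need not be restricted first.\<close>

lemma well_order_on_lex_blocks:
  fixes V :: "'a set" and r :: "'b rel"
  assumes wo: "Well_order r"
    and block: "\<And>x. x \<in> V \<Longrightarrow> m x \<in> Field r \<and> well_order_on (U (m x)) (W (m x)) \<and> x \<in> U (m x)"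
  shows "well_order_on V {(x, y). x \<in> V \<and> y \<in> V \<and>
    (m x \<in> underS r (m y) \<or> m x = m y \<and> (x, y) \<in> W (m x))}" (is "well_order_on V ?R")
proof -
  have W: "refl_on (U (m x)) (W (m x))" "trans (W (m x))" "antisym (W (m x))"
    "total_on (U (m x)) (W (m x))" "wf (W (m x) - Id)" if "x \<in> V" for x
    using block[OF that] unfolding order_on_defs by auto
  have tr: "a \<in> underS r c" if "a \<in> underS r b" "b \<in> underS r c" for a b c
    using Well_order_underS_trans[OF wo that(1)] that(2) unfolding underS_def by blast
  have irr: "a \<notin> underS r a" for a
    unfolding underS_def by blast
  have "refl_on V ?R"
    using W(1) block unfolding refl_on_def by auto
  moreover have "?R \<subseteq> V \<times> V"
    by auto
  moreover have "trans ?R"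
    unfolding trans_def using tr by (auto dest: transD[OF W(2)])
  moreover have "antisym ?R"
    unfolding antisym_def using tr irr by (auto dest: antisymD[OF W(3)])
  moreover have "total_on V ?R"
    unfolding total_on_def
  proof (intro ballI impI)
    fix x y assume xy: "x \<in> V" "y \<in> V" "x \<noteq> y"
    then have "m x \<in> underS r (m y) \<or> m y \<in> underS r (m x) \<or> m x = m y"
      using Well_order_underS_cases[OF wo, of "m x" "m y"] block unfolding underS_def by auto
    moreover have "(x, y) \<in> W (m x) \<or> (y, x) \<in> W (m x)" if "m x = m y"
      using W(4)[OF xy(1)] block[OF xy(1)] block[OF xy(2)] xy(3) that unfolding total_on_def by simp
    ultimately show "(x, y) \<in> ?R \<or> (y, x) \<in> ?R"
      using xy by auto
  qed
  moreover have "wf (?R - Id)"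
  proof (rule wfI_min)
    fix x0 and Q :: "'a set" assume x0: "x0 \<in> Q"
    show "\<exists>z\<in>Q. \<forall>y. (y, z) \<in> ?R - Id \<longrightarrow> y \<notin> Q"
    proof (cases "Q \<inter> V = {}")
      case True
      then show ?thesis
        using x0 by blast
    next
      case False
      have wfr: "wf (r - Id)"
        using wo unfolding well_order_on_def by blast
      obtain z0 where z0: "z0 \<in> m ` (Q \<inter> V)" "\<And>b. (b, z0) \<in> r - Id \<Longrightarrow> b \<notin> m ` (Q \<inter> V)"
        using wfE_min'[OF wfr, of "m ` (Q \<inter> V)"] False by blast
      then obtain z where z: "z \<in> Q \<inter> V" "z0 = m z"
        by blast
      obtain w where w: "w \<in> Q \<inter> V" "m w = m z"
        "\<And>y. (y, w) \<in> W (m z) - Id \<Longrightarrow> y \<notin> {y \<in> Q \<inter> V. m y = m z}"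
        using wfE_min'[OF W(5)[of z], of "{y \<in> Q \<inter> V. m y = m z}"] z by blast
      have "y \<notin> Q" if y: "(y, w) \<in> ?R - Id" for y
      proof
        assume "y \<in> Q"
        then have yQ: "y \<in> Q \<inter> V"
          using y by blast
        show False
        proof (cases "m y \<in> underS r (m w)")
          case True
          then show False
            using z0(2)[of "m y"] yQ w(2) z(2) unfolding underS_def by auto
        next
          case False
          then have "m y = m z" "(y, w) \<in> W (m z) - Id"
            using y w(2) by auto
          then show False
            using w(3) yQ by blast
        qed
      qed
      then show ?thesis
        using w(1) by blast
    qed
  qed
  ultimately show ?thesis
    unfolding order_on_defs by blast
qed

context locally_colorable_graph
begin

text \<open>The block of \<open>x\<close> is named by the least closure point \<open>m x\<close> above \<open>x\<close>. If \<open>y\<close> is in an earlier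
  block than \<open>x\<close>, then \<open>y < m y \<le> x\<close>, so a closure point separates them; if they share a block, both
  lie below \<open>m x\<close> and are compared as in the order given for that initial segment.\<close>

lemma coloring_bound_cardSuc_of_small_heavy:
  assumes heavy: "\<And>y. y \<in> Field \<kappa> \<Longrightarrow> |heavy_over (underS \<kappa> y)| <o \<kappa>"
  shows "coloring_bound (Field \<kappa>) E (cardSuc \<mu>)"
proof -
  define C where "C x = {a \<in> closure_points. x \<in> underS \<kappa> a}" for x
  define m where "m x = wo_rel.minim \<kappa> (C x)" for x
  have wor: "wo_rel \<kappa>"
    using wo\<kappa> by (simp add: wo_rel_def)
  have C: "C x \<subseteq> Field \<kappa>" for x
    unfolding C_def closure_points_def by blast
  have m: "m x \<in> closure_points" "m x \<in> Field \<kappa>" "x \<in> underS \<kappa> (m x)" if "x \<in> Field \<kappa>" for x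
    using wo_rel.minim_in[OF wor C, of x] closure_points_unbounded[OF heavy that] C
    unfolding m_def C_def by auto
  have least: "(m x, a) \<in> \<kappa>" if "a \<in> closure_points" "x \<in> underS \<kappa> a" for a x
    using wo_rel.minim_least[OF wor C] that unfolding m_def C_def by blast
  let ?E = "\<lambda>b. E \<inter> [underS \<kappa> b]\<^bsup>2\<^esup>"
  let ?good = "\<lambda>b w. well_order_on (underS \<kappa> b) w \<and>
      (\<forall>x\<in>underS \<kappa> b. |{y \<in> underS \<kappa> b. {x, y} \<in> ?E b \<and> y \<in> underS w x}| <o \<mu>)"
  have "\<forall>b\<in>Field \<kappa>. \<exists>w. ?good b w"
    using local_bound unfolding coloring_bound_def by (rule ballI)
  then obtain W where "\<forall>b\<in>Field \<kappa>. ?good b (W b)"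
    by (rule bchoice[THEN exE])
  then have W: "\<And>b. b \<in> Field \<kappa> \<Longrightarrow> ?good b (W b)"
    by (rule bspec)
  let ?R = "{(x, y). x \<in> Field \<kappa> \<and> y \<in> Field \<kappa> \<and>
    (m x \<in> underS \<kappa> (m y) \<or> m x = m y \<and> (x, y) \<in> W (m x))}"
  have "well_order_on (Field \<kappa>) ?R"
    using m W by (intro well_order_on_lex_blocks[OF wo\<kappa>, where U = "underS \<kappa>"]) blast
  moreover have "|{y \<in> Field \<kappa>. {x, y} \<in> E \<and> y \<in> underS ?R x}| <o cardSuc \<mu>"
    if x: "x \<in> Field \<kappa>" for x
  proof -
    let ?N1 = "{y \<in> Field \<kappa>. {x, y} \<in> E \<and> (\<exists>a\<in>closure_points. y \<in> underS \<kappa> a \<and> (a, x) \<in> \<kappa>)}"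
    let ?N2 = "{y \<in> underS \<kappa> (m x). {x, y} \<in> ?E (m x) \<and> y \<in> underS (W (m x)) x}"
    have "y \<in> ?N1 \<union> ?N2" if y: "y \<in> Field \<kappa>" "{x, y} \<in> E" "y \<in> underS ?R x" for y
    proof (cases "m y \<in> underS \<kappa> (m x)")
      case True
      have "x \<notin> underS \<kappa> (m y)"
        using least[OF m(1)[OF y(1)]] not_underS_converse[OF wo\<kappa> True] by blast
      then have "(m y, x) \<in> \<kappa>"
        using Well_order_underS_cases[OF wo\<kappa> x m(2)[OF y(1)]] by blast
      then show ?thesis
        using m[OF y(1)] y by blast
    next
      case False
      then have same: "m y = m x" "y \<in> underS (W (m x)) x"
        using y(3) unfolding underS_def by auto
      moreover have "{x, y} \<in> [underS \<kappa> (m x)]\<^bsup>2\<^esup>"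
        using m(3)[OF x] m(3)[OF y(1)] same(1) y(2) G unfolding graph_def nsets_def by auto
      ultimately show ?thesis
        using m(3)[OF y(1)] y(2) by simp
    qed
    then have "{y \<in> Field \<kappa>. {x, y} \<in> E \<and> y \<in> underS ?R x} \<subseteq> ?N1 \<union> ?N2"
      by blast
    then have "|{y \<in> Field \<kappa>. {x, y} \<in> E \<and> y \<in> underS ?R x}| \<le>o |?N1 \<union> ?N2|"
      by (rule card_of_mono1)
    also have "|?N1 \<union> ?N2| \<le>o \<mu>"
      using card_nbrs_below_closure_points[OF x] W[OF m(2)[OF x]] m(3)[OF x]
      by (intro card_of_Un_ordLeq_infinite_Field[OF \<mu>(2) _ _ \<mu>(1)]) (auto intro: ordLess_imp_ordLeq)
    finally show ?thesis
      using cardSuc_ordLeq_ordLess[OF \<mu>(1) card_of_Card_order] by blast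
  qed
  ultimately show ?thesis
    unfolding coloring_bound_def by blast
qed

end

theorem theorem2p16:
  fixes \<kappa> :: "'a rel" and \<mu> :: "'b rel" and E :: "'a set set"
  assumes "Card_order \<mu>" and "infinite (Field \<mu>)"
    and "Card_order \<kappa>" and "infinite (Field \<kappa>)"
    and "regularCard \<kappa>"
    and "\<not> (\<exists>l :: 'a rel. Card_order l \<and> infinite (Field l) \<and> \<not> regularCard l \<and>
              cf l =o cf \<mu> \<and> \<kappa> =o cardSuc l)"
    and "graph (Field \<kappa>) E"
    and "\<forall>\<alpha> \<in> Field \<kappa>. Col (underS \<kappa> \<alpha>) (E \<inter> [underS \<kappa> \<alpha>]\<^bsup>2\<^esup>) \<le>o \<mu>"
  shows "Col (Field \<kappa>) E \<le>o cardSuc \<mu>"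
proof (cases "cardSuc \<mu> <o \<kappa>")
  case True
  have local_bound: "coloring_bound (underS \<kappa> b) (E \<inter> [underS \<kappa> b]\<^bsup>2\<^esup>) \<mu>"
    if "b \<in> Field \<kappa>" for b
    using assms(8) that Col_le_iff[OF assms(1)] by blast
  interpret locally_colorable_graph \<kappa> \<mu> E
    by (rule locally_colorable_graph.intro[OF assms(1,2,3,5) True assms(7) local_bound])
  have "|heavy_over (underS \<kappa> y)| <o \<kappa>" if "y \<in> Field \<kappa>" for y
  proof (rule card_heavy_over_less[OF assms(6) _ card_of_underS[OF assms(3) that]])
    show "underS \<kappa> y \<subseteq> Field \<kappa>"
      using underS_Field by (rule subsetI)
  qed
  then show ?thesis
    by (intro iffD2[OF Col_le_iff[OF cardSuc_Card_order[OF assms(1)]]]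
        coloring_bound_cardSuc_of_small_heavy)
next
  case False
  have wo: "well_order_on (Field \<kappa>) \<kappa>"
    using assms(3) by (simp add: card_order_on_def)
  have le: "\<kappa> \<le>o cardSuc \<mu>"
    using False ordLess_or_ordLeq cardSuc_Card_order[OF assms(1)] wo
    by (metis card_order_on_well_order_on)
  have "|{y \<in> Field \<kappa>. {x, y} \<in> E \<and> y \<in> underS \<kappa> x}| <o cardSuc \<mu>" if x: "x \<in> Field \<kappa>" for x
  proof -
    have "|{y \<in> Field \<kappa>. {x, y} \<in> E \<and> y \<in> underS \<kappa> x}| \<le>o |underS \<kappa> x|"
      by (rule card_of_mono1) blast
    then show ?thesis
      using card_of_underS[OF assms(3) x] le ordLeq_ordLess_trans ordLess_ordLeq_trans by blast
  qed
  then have "coloring_bound (Field \<kappa>) E (cardSuc \<mu>)"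
    using wo unfolding coloring_bound_def by blast
  then show ?thesis
    using Col_le_iff[OF cardSuc_Card_order[OF assms(1)]] by blast
qed

end
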